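(* Let $m\in\mathbb{Z}$. There exists an integer $n\in\mathbb{Z}\setminus\{m,-m-3\}$ such that $L^{(6)}_n=L^{(6)}_m$ if and only if there exist $(x,y)\in\mathbb{Z}^2$ with $xy(x+y)(x-y)(x+2y)(2x+y)\neq 0$ and a (positive or negative) divisor $\lambda\in\mathbb{Z}$ of $27(m^2+3m+9)$ such that $F_m(x,y)=\lambda$.
   Context: For $m\in\mathbb{Z}$, $F_m(X,Y)=X^6-2mX^5Y-5(m+3)X^4Y^2-20X^3Y^3+5mX^2Y^4+2(m+3)XY^5+Y^6$. Let $f^{C_6}_m(X)=F_m(X,1)=X^6-2mX^5-5(m+3)X^4-20X^3+5mX^2+2(m+3)X+1\in\mathbb{Q}[X]$, and let $L^{(6)}_m=\mathrm{Spl}_{\mathbb{Q}}f^{C_6}_m(X)$ be the splitting field of $f^{C_6}_m(X)$ over $\mathbb{Q}$ inside a fixed algebraic closure $\overline{\mathbb{Q}}$ of $\mathbb{Q}$. *)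

theory Defs
  imports
    "HOL-Algebra.Algebraic_Closure_Type"
    "HOL-Algebra.Generated_Fields"
    "HOL-Computational_Algebra.Polynomial"
begin

text \<open>
  The splitting field of \<open>p\<close> over the field \<open>'a\<close>, as a subset of the fixed algebraic
  closure \<^typ>\<open>'a alg_closure\<close>: the subfield generated by the base field \<open>range to_ac\<close>
  and by all roots of \<open>p\<close>.
\<close>
definition splitting_field :: "'a::field poly \<Rightarrow> 'a alg_closure set" where
  "splitting_field p =
     generate_field (ring_of_type_algebra :: 'a alg_closure ring)
       (range to_ac \<union> {\<alpha>. poly (map_poly to_ac p) \<alpha> = 0})"

definition F :: "int \<Rightarrow> 'a::comm_ring_1 \<Rightarrow> 'a \<Rightarrow> 'a" where
  "F m x y = x^6 - 2 * of_int m * x^5 * y - 5 * of_int (m + 3) * x^4 * y^2 - 20 * x^3 * y^3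
     + 5 * of_int m * x^2 * y^4 + 2 * of_int (m + 3) * x * y^5 + y^6"

definition fC6 :: "int \<Rightarrow> rat poly" where
  "fC6 m = F m [:0, 1:] 1"

definition L6 :: "int \<Rightarrow> rat alg_closure set" where
  "L6 m = splitting_field (fC6 m)"

end

theory Submission
  imports Defs
begin

text \<open>
  Write \<open>F m = P - m Q\<close>. The map \<open>a \<mapsto> (a - 1) / (a + 2)\<close> has order 6 and permutes the roots of
  \<open>F m\<close> simply transitively. It belongs to the group of fractional linear maps
  \<open>b \<mapsto> (x b - y) / (y b + x + y)\<close> (a torus), under which the pair \<open>(P, Q)\<close> composes like
  \<open>P - Q \<eta>\<close> with \<open>\<eta>\<^sup>2 + 3 \<eta> + 9 = 0\<close>. Hence \<open>(x, y)\<close> carries roots of \<open>F n\<close> to roots of \<open>F m\<close>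
  precisely if \<open>(n - m) F m x y = (m\<^sup>2 + 3 m + 9) Q x y\<close>.

  A solution \<open>F m x y = d\<close> makes the \<open>n\<close> determined by this equation an integer, and a rational
  \<open>(x, y)\<close> preserves the splitting field. Conversely let \<open>L n = L m\<close>, with roots \<open>a\<close> and \<open>b\<close>.
  Each automorphism acts on \<open>a\<close> and on \<open>b\<close> by powers of the order 6 map whose exponents agree,
  uniformly up to one sign; the sign is removed by passing from \<open>b\<close> to \<open>1 / b\<close>, that is, from \<open>n\<close> to
  \<open>- n - 3\<close>. The torus element carrying \<open>b\<close> to \<open>a\<close> is then invariant under all automorphisms, hence
  rational. No irreducibility of \<open>F m\<close> is needed, so the \<open>m\<close> with cubic splitting field are not special.
\<close>

section \<open>Splitting fields generated by one root\<close>

definition ev :: "'a::field poly \<Rightarrow> 'a alg_closure \<Rightarrow> 'a alg_closure" where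
  "ev p a = poly (map_poly to_ac p) a"

lemma ev_0 [simp]: "ev 0 a = 0"
  and ev_1 [simp]: "ev 1 a = 1"
  and ev_pCons [simp]: "ev (pCons c p) a = to_ac c + a * ev p a"
  by (simp_all add: ev_def map_poly_pCons)

lemma ev_add [simp]: "ev (p + q) a = ev p a + ev q a"
  by (induction p q rule: poly_induct2) (simp_all add: algebra_simps)

lemma ev_smult [simp]: "ev (smult c p) a = to_ac c * ev p a"
  by (induction p) (simp_all add: algebra_simps)

lemma ev_diff [simp]: "ev (p - q) a = ev p a - ev q a"
  using ev_add[of "p - q" q a] by (simp del: ev_add)

lemma ev_minus [simp]: "ev (- p) a = - ev p a"
  using ev_diff[of 0 p a] by simp

lemma ev_mult [simp]: "ev (p * q) a = ev p a * ev q a"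
  by (induction p) (simp_all add: algebra_simps)

lemma ev_power [simp]: "ev (p ^ n) a = ev p a ^ n"
  by (induction n) simp_all

lemma ev_of_int [simp]: "ev (of_int n) a = of_int n"
  by (simp add: of_int_poly)

lemma ev_numeral [simp]: "ev (numeral n) a = numeral n"
  using ev_of_int[of "numeral n" a] by simp

lemma ev_pcompose: "ev (pcompose p q) a = ev p (ev q a)"
  by (induction p) (simp_all add: pcompose_pCons)

text \<open>Polynomial values suffice: \<open>\<alpha>\<close> is algebraic, so this ring is already
  a field.\<close>

definition adjoin :: "'a::field alg_closure \<Rightarrow> 'a alg_closure set" where
  "adjoin \<alpha> = range (\<lambda>p. ev p \<alpha>)"

definition is_subfield :: "'a::field set \<Rightarrow> bool" where
  "is_subfield K \<longleftrightarrow> 1 \<in> K \<and> (\<forall>x\<in>K. - x \<in> K \<and> inverse x \<in> K) \<and> (\<forall>x\<in>K. \<forall>y\<in>K. x + y \<in> K \<and> x * y \<in> K)"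

lemma is_subfieldD:
  assumes "is_subfield K"
  shows "1 \<in> K" "0 \<in> K" "x \<in> K \<Longrightarrow> - x \<in> K" "x \<in> K \<Longrightarrow> inverse x \<in> K"
    "x \<in> K \<Longrightarrow> y \<in> K \<Longrightarrow> x + y \<in> K" "x \<in> K \<Longrightarrow> y \<in> K \<Longrightarrow> x - y \<in> K"
    "x \<in> K \<Longrightarrow> y \<in> K \<Longrightarrow> x * y \<in> K" "x \<in> K \<Longrightarrow> y \<in> K \<Longrightarrow> x / y \<in> K"
proof -
  have K: "1 \<in> K" "\<And>x. x \<in> K \<Longrightarrow> - x \<in> K" "\<And>x. x \<in> K \<Longrightarrow> inverse x \<in> K"
    "\<And>x y. x \<in> K \<Longrightarrow> y \<in> K \<Longrightarrow> x + y \<in> K" "\<And>x y. x \<in> K \<Longrightarrow> y \<in> K \<Longrightarrow> x * y \<in> K"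
    using assms by (auto simp: is_subfield_def)
  have "0 \<in> K" using K(4)[OF K(1) K(2)[OF K(1)]] by simp
  with K show "1 \<in> K" "0 \<in> K" "x \<in> K \<Longrightarrow> - x \<in> K" "x \<in> K \<Longrightarrow> inverse x \<in> K"
    "x \<in> K \<Longrightarrow> y \<in> K \<Longrightarrow> x + y \<in> K" "x \<in> K \<Longrightarrow> y \<in> K \<Longrightarrow> x - y \<in> K"
    "x \<in> K \<Longrightarrow> y \<in> K \<Longrightarrow> x * y \<in> K" "x \<in> K \<Longrightarrow> y \<in> K \<Longrightarrow> x / y \<in> K"
    by (auto simp only: diff_conv_add_uminus field_class.field_divide_inverse)
qed

lemma adjoinI [intro]: "ev p \<alpha> \<in> adjoin \<alpha>"
  by (auto simp: adjoin_def)

lemma adjoin_self [simp]: "\<alpha> \<in> adjoin \<alpha>"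
  using adjoinI[of "[:0, 1:]" \<alpha>] by simp

lemma to_ac_in_adjoin [simp]: "to_ac c \<in> adjoin \<alpha>"
  using adjoinI[of "[:c:]" \<alpha>] by simp

text \<open>Take \<open>g\<close> nonzero of least degree among the polynomials vanishing at
  \<open>\<alpha>\<close> and divide with remainder.\<close>

lemma min_poly_exists:
  fixes \<alpha> :: "'a::field_gcd alg_closure"
  obtains g where "g \<noteq> 0" "\<And>p. ev p \<alpha> = 0 \<longleftrightarrow> g dvd p"
proof -
  obtain p :: "'a poly" where "p \<noteq> 0" "ev p \<alpha> = 0"
    by (metis alg_closure_algebraic ev_def)
  then obtain g where g: "g \<noteq> 0" "ev g \<alpha> = 0"
    and min: "\<And>q. q \<noteq> 0 \<Longrightarrow> ev q \<alpha> = 0 \<Longrightarrow> degree g \<le> degree q"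
    using ex_has_least_nat[of "\<lambda>p. p \<noteq> 0 \<and> ev p \<alpha> = 0" p degree] by metis
  have "ev p \<alpha> = 0 \<longleftrightarrow> g dvd p" for p
  proof
    assume "ev p \<alpha> = 0"
    moreover have "p = g * (p div g) + p mod g" by simp
    then have "ev p \<alpha> = ev g \<alpha> * ev (p div g) \<alpha> + ev (p mod g) \<alpha>"
      by (metis ev_add ev_mult)
    ultimately have "ev (p mod g) \<alpha> = 0" using g by simp
    with min have "p mod g = 0"
      using degree_mod_less[OF g(1), of p] by fastforce
    then show "g dvd p" by auto
  qed (use g in auto)
  with g show ?thesis using that by blast
qed

lemma is_subfield_adjoin:
  fixes \<alpha> :: "'a::field_gcd alg_closure"
  shows "is_subfield (adjoin \<alpha>)"
proof -
  obtain g where g: "g \<noteq> 0" "\<And>p. ev p \<alpha> = 0 \<longleftrightarrow> g dvd p"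
    using min_poly_exists[of \<alpha>] by blast
  have inv: "inverse (ev p \<alpha>) \<in> adjoin \<alpha>" for p
  proof (cases "ev p \<alpha> = 0")
    case True
    then show ?thesis using to_ac_in_adjoin[of 0 \<alpha>] by simp
  next
    case False
    \<comment> \<open>\<open>d\<close> divides \<open>p\<close>, so it does not vanish at
      \<open>\<alpha>\<close>. The cofactor \<open>e\<close> then does and is a multiple of
      \<open>g\<close>, which leaves \<open>d\<close> constant; Bezout turns \<open>u\<close>, up to
      scaling, into an inverse of \<open>p\<close> at \<open>\<alpha>\<close>.\<close>
    define d where "d = gcd p g"
    obtain u v where uv: "u * p + v * g = d"
      unfolding d_def using bezout_coefficients_fst_snd by metis
    have "ev g \<alpha> = 0" using g(2) by simp
    with uv have d: "ev d \<alpha> = ev u \<alpha> * ev p \<alpha>" by auto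
    have "d dvd p" by (simp add: d_def)
    with False have "ev d \<alpha> \<noteq> 0" by (auto elim!: dvdE)
    obtain e where e: "g = d * e" by (metis d_def gcd_dvd2 dvdE)
    with \<open>ev g \<alpha> = 0\<close> \<open>ev d \<alpha> \<noteq> 0\<close> have "ev e \<alpha> = 0" by simp
    then have "g dvd e" by (simp only: g(2))
    moreover have "d \<noteq> 0" "e \<noteq> 0" using e g(1) by auto
    ultimately have "degree d = 0"
      using dvd_imp_degree_le[of g e] e by (simp add: degree_mult_eq)
    then obtain c where c: "d = [:c:]" by (metis degree_eq_zeroE)
    with \<open>d \<noteq> 0\<close> have "c \<noteq> 0" by simp
    from c d have "to_ac c = ev u \<alpha> * ev p \<alpha>" by simp
    moreover from this have "ev u \<alpha> \<noteq> 0" using \<open>c \<noteq> 0\<close> by auto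
    ultimately have "inverse (ev p \<alpha>) = ev (smult (inverse c) u) \<alpha>"
      using False by (simp add: field_simps)
    then show ?thesis by (metis adjoinI)
  qed
  have "ev p \<alpha> + ev q \<alpha> \<in> adjoin \<alpha>" "ev p \<alpha> * ev q \<alpha> \<in> adjoin \<alpha>" "- ev p \<alpha> \<in> adjoin \<alpha>" for p q
    using adjoinI[of "p + q" \<alpha>] adjoinI[of "p * q" \<alpha>] adjoinI[of "- p" \<alpha>] by auto
  with inv show ?thesis
    unfolding is_subfield_def using adjoinI[of 1 \<alpha>] by (auto simp: adjoin_def)
qed

text \<open>Translates \<open>generate_field\<close> over a ring record into type class operations;
  afterwards splitting fields are handled through these four facts.\<close>

lemma splitting_field_subfield:
  fixes p :: "'a::field poly"
  shows "is_subfield (splitting_field p)" "to_ac c \<in> splitting_field p"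
    "ev p a = 0 \<Longrightarrow> a \<in> splitting_field p"
    "is_subfield K \<Longrightarrow> range to_ac \<subseteq> K \<Longrightarrow> {a. ev p a = 0} \<subseteq> K \<Longrightarrow> splitting_field p \<subseteq> K"
proof -
  define R where "R = (ring_of_type_algebra :: 'a alg_closure ring)"
  interpret R: field R unfolding R_def by rule
  have R: "one R = 1" "ring.zero R = 0" "monoid.mult R = (*)" "ring.add R = (+)" "carrier R = UNIV"
    by (simp_all add: R_def ring_of_type_algebra_def)
  have minus: "\<ominus>\<^bsub>R\<^esub> x = - x" for x
    using R.minus_equality[of "- x" x] by (simp add: R)
  have inv: "inv\<^bsub>R\<^esub> x = inverse x" if "x \<noteq> 0" for x
    using R.comm_inv_char[of x "inverse x"] that by (simp add: R)
  define H where "H = range to_ac \<union> {a. ev p a = 0}"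
  have S: "splitting_field p = generate_field R H"
    by (simp add: splitting_field_def R_def H_def ev_def)
  have incl: "h \<in> splitting_field p" if "h \<in> H" for h
    using generate_field.incl[OF that, of R] by (simp add: S)
  show c: "to_ac c \<in> splitting_field p" for c by (rule incl) (simp add: H_def)
  show "ev p a = 0 \<Longrightarrow> a \<in> splitting_field p" by (rule incl) (simp add: H_def)
  have "inverse x \<in> splitting_field p" if "x \<in> splitting_field p" for x
    using generate_field.m_inv[of x R H] that c[of 0] inv[of x] by (cases "x = 0") (simp_all add: S R)
  moreover have "- x \<in> splitting_field p" if "x \<in> splitting_field p" for x
    using generate_field.a_inv[of x R H] that by (simp add: S minus)
  moreover have "x + y \<in> splitting_field p" "x * y \<in> splitting_field p"
    if "x \<in> splitting_field p" "y \<in> splitting_field p" for x y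
    using generate_field.eng_add[of x R H y] generate_field.eng_mult[of x R H y] that by (simp_all add: S R)
  ultimately show "is_subfield (splitting_field p)"
    using c[of 1] by (simp add: is_subfield_def)
  show "splitting_field p \<subseteq> K" if K: "is_subfield K" "range to_ac \<subseteq> K" "{a. ev p a = 0} \<subseteq> K"
  proof
    fix x assume "x \<in> splitting_field p"
    then show "x \<in> K" unfolding S
    proof (induction rule: generate_field.induct)
      case (m_inv h)
      then show ?case using is_subfieldD(4)[OF K(1)] by (simp add: inv R)
    qed (use K is_subfieldD[OF K(1)] in \<open>auto simp: R minus H_def\<close>)
  qed
qed

lemma splitting_field_eq_adjoin:
  fixes p :: "'a::field_gcd poly"
  assumes "ev p \<alpha> = 0" "{a. ev p a = 0} \<subseteq> adjoin \<alpha>"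
  shows "splitting_field p = adjoin \<alpha>"
proof
  show "splitting_field p \<subseteq> adjoin \<alpha>"
    by (rule splitting_field_subfield(4)) (use assms(2) is_subfield_adjoin in auto)
  note S = splitting_field_subfield[where p = p]
  have "ev q \<alpha> \<in> splitting_field p" for q
    by (induction q) (use is_subfieldD[OF S(1)] S(2,3) assms(1) in auto)
  then show "adjoin \<alpha> \<subseteq> splitting_field p" by (auto simp: adjoin_def)
qed

section \<open>Automorphisms over the base field and the elements they fix\<close>

text \<open>Off \<open>K\<close> (and the base field) an element of \<open>aut K\<close> is arbitrary.\<close>
definition aut :: "'a::field alg_closure set \<Rightarrow> ('a alg_closure \<Rightarrow> 'a alg_closure) set" where
  "aut K = {\<tau>. (\<forall>c. \<tau> (to_ac c) = to_ac c) \<and> (\<forall>x\<in>K. \<tau> x \<in> K) \<and>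
     (\<forall>x\<in>K. \<forall>y\<in>K. \<tau> (x + y) = \<tau> x + \<tau> y \<and> \<tau> (x * y) = \<tau> x * \<tau> y)}"

lemma aut_comp: "\<sigma> \<in> aut K \<Longrightarrow> \<tau> \<in> aut K \<Longrightarrow> \<sigma> \<circ> \<tau> \<in> aut K"
  by (auto simp: aut_def)

lemma autD:
  assumes "\<tau> \<in> aut K" "is_subfield K" "range to_ac \<subseteq> K"
  shows "\<tau> (to_ac c) = to_ac c"
    and "x \<in> K \<Longrightarrow> \<tau> x \<in> K"
    and "x \<in> K \<Longrightarrow> y \<in> K \<Longrightarrow> \<tau> (x + y) = \<tau> x + \<tau> y"
    and "x \<in> K \<Longrightarrow> y \<in> K \<Longrightarrow> \<tau> (x * y) = \<tau> x * \<tau> y"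
    and "x \<in> K \<Longrightarrow> y \<in> K \<Longrightarrow> \<tau> (x - y) = \<tau> x - \<tau> y"
    and "x \<in> K \<Longrightarrow> y \<in> K \<Longrightarrow> \<tau> (x / y) = \<tau> x / \<tau> y"
    and "x \<in> K \<Longrightarrow> ev p x \<in> K \<and> \<tau> (ev p x) = ev p (\<tau> x)"
proof -
  note K = is_subfieldD[OF assms(2)]
  have c: "\<tau> (to_ac c) = to_ac c" and cK: "to_ac c \<in> K" for c
    using assms by (auto simp: aut_def)
  have add: "\<tau> (x + y) = \<tau> x + \<tau> y" and mult: "\<tau> (x * y) = \<tau> x * \<tau> y" 
    if "x \<in> K" "y \<in> K" for x y
    using assms(1) that by (auto simp: aut_def)
  show "\<tau> (to_ac c) = to_ac c" by (rule c)
  show "x \<in> K \<Longrightarrow> \<tau> x \<in> K" using assms(1) by (auto simp: aut_def)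
  show "x \<in> K \<Longrightarrow> y \<in> K \<Longrightarrow> \<tau> (x + y) = \<tau> x + \<tau> y" by (rule add)
  show "x \<in> K \<Longrightarrow> y \<in> K \<Longrightarrow> \<tau> (x * y) = \<tau> x * \<tau> y" by (rule mult)
  show "\<tau> (x - y) = \<tau> x - \<tau> y" if "x \<in> K" "y \<in> K"
    using add[of "x - y" y] K(6)[OF that] that by simp
  show "\<tau> (x / y) = \<tau> x / \<tau> y" if xy: "x \<in> K" "y \<in> K"
  proof (cases "y = 0")
    case True
    then show ?thesis using c[of 0] by simp
  next
    case False
    have "\<tau> y * \<tau> (inverse y) = 1" using mult[of y "inverse y"] K xy False c[of 1] by simp
    then have "\<tau> y \<noteq> 0" by auto
    moreover have "\<tau> x = \<tau> (x / y) * \<tau> y" using mult[of "x / y" y] K xy False by simp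
    ultimately show ?thesis by simp
  qed
  show "ev p x \<in> K \<and> \<tau> (ev p x) = ev p (\<tau> x)" if x: "x \<in> K"
  proof (induction p)
    case 0
    then show ?case using c[of 0] K by simp
  next
    case (pCons d p)
    then show ?case using x K cK[of d] add[of "to_ac d" "x * ev p x"] mult[of x "ev p x"] c[of d] by simp
  qed
qed

lemma degree_map_to_ac [simp]: "degree (map_poly to_ac p) = degree p"
  by (simp add: degree_map_poly)

lemma map_to_ac_eq_0_iff [simp]: "map_poly to_ac p = 0 \<longleftrightarrow> p = 0"
  by (auto simp: poly_eq_iff coeff_map_poly)

lemma ev_roots: 
  assumes "p \<noteq> 0"
  shows "finite {a. ev p a = 0}" "card {a. ev p a = 0} \<le> degree p"
  using poly_roots_finite[of "map_poly to_ac p"] card_poly_roots_bound[of "map_poly to_ac p"] assms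
  by (simp_all add: ev_def)

text \<open>By \<open>conj\<close>, polynomials that agree at \<open>\<alpha>\<close> agree at
  \<open>a\<close>, so replacing \<open>\<alpha>\<close> by \<open>a\<close> is well defined
  whichever representing polynomial is chosen.\<close>

lemma conjugate_aut:
  fixes \<alpha> :: "'a::field_gcd alg_closure"
  assumes conj: "\<And>p. ev p \<alpha> = 0 \<Longrightarrow> ev p a = 0" and a: "a \<in> adjoin \<alpha>"
  obtains \<tau> where "\<tau> \<in> aut (adjoin \<alpha>)" "\<And>p. \<tau> (ev p \<alpha>) = ev p a"
proof -
  define \<tau> where "\<tau> x = ev (SOME p. ev p \<alpha> = x) a" for x
  have \<tau>: "\<tau> (ev p \<alpha>) = ev p a" for p
  proof -
    have "ev (SOME q. ev q \<alpha> = ev p \<alpha>) \<alpha> = ev p \<alpha>" by (rule someI) (rule refl)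
    then show ?thesis using conj[of "(SOME q. ev q \<alpha> = ev p \<alpha>) - p"] by (simp add: \<tau>_def)
  qed
  have "\<tau> (to_ac c) = to_ac c" for c using \<tau>[of "[:c:]"] by simp
  moreover have "\<tau> (ev p \<alpha> + ev q \<alpha>) = \<tau> (ev p \<alpha>) + \<tau> (ev q \<alpha>)"
    "\<tau> (ev p \<alpha> * ev q \<alpha>) = \<tau> (ev p \<alpha>) * \<tau> (ev q \<alpha>)" for p q
    using \<tau>[of "p + q"] \<tau>[of "p * q"] by (simp_all add: \<tau>)
  moreover have "\<tau> (ev p \<alpha>) \<in> adjoin \<alpha>" for p
  proof -
    obtain s where "a = ev s \<alpha>" using a by (auto simp: adjoin_def)
    then show ?thesis using adjoinI[of "pcompose p s" \<alpha>] by (simp add: \<tau> ev_pcompose)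
  qed
  ultimately have "\<tau> \<in> aut (adjoin \<alpha>)" by (auto simp: aut_def adjoin_def)
  with \<tau> that show ?thesis by blast
qed

text \<open>
  If \<open>g\<close> is a generator of the ideal of polynomials vanishing at \<open>\<alpha>\<close> and \<open>x = ev r \<alpha>\<close> with
  \<open>degree r < degree g\<close>, then \<open>r - x\<close> vanishes at all \<open>degree g\<close> roots of \<open>g\<close>, so \<open>r\<close> is constant.
\<close>
lemma fixed_field_adjoin:
  fixes \<alpha> :: "'a::field_gcd alg_closure"
  assumes "f \<noteq> 0" "ev f \<alpha> = 0" "card {a. ev f a = 0} = degree f" "{a. ev f a = 0} \<subseteq> adjoin \<alpha>"
    and x: "x \<in> adjoin \<alpha>" and fixed: "\<And>\<tau>. \<tau> \<in> aut (adjoin \<alpha>) \<Longrightarrow> \<tau> x = x"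
  shows "x \<in> range to_ac"
proof -
  obtain g where g: "g \<noteq> 0" "\<And>p. ev p \<alpha> = 0 \<longleftrightarrow> g dvd p"
    using min_poly_exists[of \<alpha>] by blast
  obtain h where h: "f = g * h" using assms(2) g(2) by (auto elim!: dvdE)
  define G where "G = {a. ev g a = 0}"
  have "h \<noteq> 0" using h assms(1) by auto
  \<comment> \<open>\<open>f\<close> has \<open>degree f\<close> distinct roots and \<open>h\<close>
    at most \<open>degree h\<close>, so \<open>g\<close> has at least
    \<open>degree g\<close>.\<close>
  have "degree g + degree h = card {a. ev f a = 0}"
    using h assms(1,3) by (simp add: degree_mult_eq)
  also have "{a. ev f a = 0} = G \<union> {a. ev h a = 0}" by (auto simp: h G_def)
  also have "card \<dots> \<le> card G + card {a. ev h a = 0}" by (rule card_Un_le)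
  also have "card {a. ev h a = 0} \<le> degree h" using \<open>h \<noteq> 0\<close> by (rule ev_roots)
  finally have card: "degree g \<le> card G" by simp
  have "ev g \<alpha> = 0" by (simp add: g(2))
  then have "degree g \<noteq> 0" using g(1)
    by (metis degree_eq_zeroE ev_0 ev_pCons add_0_right mult_zero_right pCons_0_0 to_ac_eq_0_iff)
  obtain q where q: "x = ev q \<alpha>" using x by (auto simp: adjoin_def)
  define r where "r = q mod g"
  have "q = g * (q div g) + r" by (simp add: r_def)
  then have r: "x = ev r \<alpha>" using q \<open>ev g \<alpha> = 0\<close> by (metis add_0 ev_add ev_mult mult_zero_left)
  \<comment> \<open>Each root of \<open>g\<close> is a conjugate of \<open>\<alpha>\<close>, so some
    automorphism carries \<open>ev r \<alpha>\<close> to \<open>ev r a\<close>.\<close>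
  have r_G: "ev r a = x" if "a \<in> G" for a
  proof -
    have "ev p a = 0" if "ev p \<alpha> = 0" for p
      using that \<open>a \<in> G\<close> g(2) by (auto simp: G_def elim!: dvdE)
    moreover have "a \<in> adjoin \<alpha>" using that assms(4) h by (auto simp: G_def)
    ultimately obtain \<tau> where "\<tau> \<in> aut (adjoin \<alpha>)" "\<And>p. \<tau> (ev p \<alpha>) = ev p a"
      using conjugate_aut by blast
    then show ?thesis using fixed[of \<tau>] r by simp
  qed
  define s where "s = map_poly to_ac r - [:x:]"
  have "degree r < degree g"
    using degree_mod_less'[of g q] g(1) \<open>degree g \<noteq> 0\<close> by (cases "r = 0") (auto simp: r_def)
  then have "degree s < degree g"
    using \<open>degree g \<noteq> 0\<close> degree_diff_le_max[of "map_poly to_ac r" "[:x:]"] by (simp add: s_def)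
  have "s = 0"
  proof (rule ccontr)
    assume "s \<noteq> 0"
    then have "card {a. poly s a = 0} \<le> degree s" "finite {a. poly s a = 0}"
      by (rule card_poly_roots_bound, simp add: poly_roots_finite)
    moreover have "G \<subseteq> {a. poly s a = 0}" using r_G by (auto simp: s_def ev_def)
    ultimately show False using card \<open>degree s < degree g\<close> card_mono by (metis leD le_trans)
  qed
  then have "x = to_ac (coeff r 0)" 
    by (metis (no_types, lifting) coeff_map_poly coeff_pCons_0 eq_iff_diff_eq_0 s_def to_ac_0)
  then show ?thesis by simp
qed

section \<open>The forms P and Q\<close>

definition P :: "'a::comm_ring_1 \<Rightarrow> 'a \<Rightarrow> 'a" where
  "P x y = x^6 - 15 * x^4 * y^2 - 20 * x^3 * y^3 + 6 * x * y^5 + y^6"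

definition Q :: "'a::comm_ring_1 \<Rightarrow> 'a \<Rightarrow> 'a" where
  "Q x y = x * y * (x + y) * (x - y) * (x + 2 * y) * (2 * x + y)"

text \<open>The homogenised simplest cubic polynomial of Shanks.\<close>

definition C :: "int \<Rightarrow> int \<Rightarrow> int \<Rightarrow> int" where
  "C m x y = x^3 - m * x^2 * y - (m + 3) * x * y^2 - y^3"

lemma F_eq: "F m (x) y = P x y - of_int m * Q x y"
  unfolding F_def P_def Q_def by (simp add: algebra_simps eval_nat_numeral)

text \<open>Let \<open>\<rho>^2 = \<rho> - 1\<close>, so that \<open>\<rho>\<close> is a primitive
  sixth root of unity. Then \<open>(x + y * \<rho>)^6 = P x y + 3 * Q x y * \<rho>\<close>. The
  arguments on the left are the coordinates of \<open>(x + y * \<rho>) * (a + b * \<rho>)\<close>;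
  this lemma and the next compare sixth powers.\<close>

lemma P_mult:
  "P (x * a - y * b) (y * a + x * b + y * b) = P x y * P a b - 9 * (Q x y * Q a b)"
  unfolding P_def Q_def by (simp add: algebra_simps eval_nat_numeral)

lemma Q_mult:
  "Q (x * a - y * b) (y * a + x * b + y * b) = P x y * Q a b + Q x y * P a b + 3 * (Q x y * Q a b)"
  unfolding P_def Q_def by (simp add: algebra_simps eval_nat_numeral)

text \<open>The norm of \<open>(x + y * \<rho>)^6\<close>, computed in two ways.\<close>

lemma norm_P_Q: "P x (y) ^ 2 + 3 * P x y * Q x y + 9 * Q x y ^ 2 = (x^2 + x * y + y^2) ^ 6"
  unfolding P_def Q_def by (simp add: algebra_simps eval_nat_numeral)

text \<open>The new arguments are the coordinates of \<open>(1 + \<rho>) * (x + y * \<rho>)\<close>,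
  and \<open>(1 + \<rho>)^6 = - 27\<close>.\<close>

lemma F_rot: "F m (x - y) (x + 2 * y) = - 27 * F m x y"
  unfolding F_eq P_def Q_def by (simp add: algebra_simps eval_nat_numeral)

lemma Q_rot: "Q (x - y) (x + 2 * y) = - 27 * Q x y"
  unfolding Q_def by (simp add: algebra_simps eval_nat_numeral)

lemma F_neg: "F (- m - 3) y x = F m x y"
  unfolding F_def by (simp add: algebra_simps eval_nat_numeral)

text \<open>
  The left-hand side vanishes iff \<open>n = - m - 3\<close> satisfies \<open>(n - m) F m x y = (m\<^sup>2 + 3 m + 9) Q x y\<close>;
  the right-hand side shows that this never happens, because \<open>C\<close> is odd on coprime arguments.
\<close>
lemma C_mult_C:
  "(2 * m + 3) * F m x y + (m^2 + 3 * m + 9) * Q x y = - (C m x y * C m (x - y) (x + 2 * y))"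
  unfolding F_def C_def Q_def of_int_eq_id id_apply by (simp add: algebra_simps eval_nat_numeral)

lemma F_homog: "F m (c * x) (c * y) = c ^ 6 * F m x y"
  and Q_homog: "Q (c * x) (c * y) = c ^ 6 * Q x y"
  and P_homog: "P (c * x) (c * y) = c ^ 6 * P x y"
  by (simp_all add: F_def Q_def P_def algebra_simps eval_nat_numeral)

lemma F_of_int: "F m (of_int x) (of_int y) = of_int (F m x y)"
  and Q_of_int: "Q (of_int x) (of_int y) = of_int (Q x y)"
  by (simp_all add: F_def Q_def)

section \<open>Positivity, coprimality and divisibility by 3 of the forms\<close>

lemma disc_pos: "m^2 + 3 * m + 9 > (0::int)"
proof -
  have "4 * (m^2 + 3 * m + 9) = (2 * m + 3)^2 + 27" by (simp add: power2_eq_square algebra_simps)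
  also have "\<dots> > 0" by (simp add: add_nonneg_pos)
  finally show ?thesis by (rule zero_less_mult_pos) simp
qed

lemma form_pos: 
  fixes x y :: int
  assumes "(x, y) \<noteq> (0, 0)"
  shows "x^2 + x * y + y^2 > 0"
proof -
  have "4 * (x^2 + x * y + y^2) = (2 * x + y)^2 + 3 * y^2" by (simp add: power2_eq_square algebra_simps)
  also have "\<dots> > 0"
    using assms by (cases "y = 0") (auto intro: add_nonneg_pos)
  finally show ?thesis by (rule zero_less_mult_pos) simp
qed

text \<open>Divide \<open>P\<close> by each linear factor of \<open>Q\<close>; the long polynomials
  below are the quotients. The remainder is the sixth power of a coordinate, times
  \<open>- 27\<close> for \<open>x - y\<close>, \<open>x + 2 * y\<close> and
  \<open>2 * x + y\<close>. These three agree with \<open>x - y\<close> up to sign modulo 3, hence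
  are prime to 3.\<close>

lemma coprime_P_Q:
  fixes x y :: int
  assumes "coprime x y" "\<not> 3 dvd x - y"
  shows "coprime (P x y) (Q x y)"
proof -
  have *: "coprime f c" if "f = c * r + e" "coprime c e" for f c r e :: int
    using that gcd_add_mult[of c r e] by (simp add: coprime_iff_gcd_eq_1 gcd.commute[of _ c] mult.commute)
  have three: "coprime c (- 27 * e)" if "\<not> 3 dvd c" "coprime c e" for c e :: int
  proof -
    have "prime (3 :: int)" by simp
    with that(1) have "coprime 3 c" by (rule prime_imp_coprime[rotated])
    then have "coprime (3 ^ 3) c" by (rule coprime_power_left_iff[THEN iffD2, OF disjI1])
    then have "coprime c 27" by (simp add: coprime_commute)
    then show ?thesis using that(2) by simp
  qed
  have cop: "coprime (x + y) y" "coprime (x - y) y" "coprime (x + 2 * y) y" "coprime (2 * x + y) x"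
    by (rule *[of _ _ 1 x], simp, simp add: assms(1) coprime_commute)
      (rule *[of _ _ "- 1" x], simp, simp add: assms(1) coprime_commute,
       rule *[of _ _ 2 x], simp, simp add: assms(1) coprime_commute,
       rule *[of _ _ 2 y], simp, simp add: assms(1))
  have "coprime (P x y) x"
    by (rule *[of _ _ "x^5 - 15*x^3*y^2 - 20*x^2*y^3 + 6*y^5" "y^6"])
      (use assms(1) in \<open>simp_all add: P_def algebra_simps eval_nat_numeral\<close>)
  moreover have "coprime (P x y) y"
    by (rule *[of _ _ "- 15*x^4*y - 20*x^3*y^2 + 6*x*y^4 + y^5" "x^6"])
      (use assms(1) in \<open>simp_all add: P_def algebra_simps eval_nat_numeral coprime_commute\<close>)
  moreover have "coprime (P x y) (x + y)"
    by (rule *[of _ _ "x^5 - x^4*y - 14*x^3*y^2 - 6*x^2*y^3 + 6*x*y^4" "y^6"])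
      (simp add: P_def algebra_simps eval_nat_numeral, use cop in simp)
  moreover have "coprime (P x y) (x - y)"
    by (rule *[of _ _ "x^5 + x^4*y - 14*x^3*y^2 - 34*x^2*y^3 - 34*x*y^4 - 28*y^5" "- 27 * y^6"])
      (simp add: P_def algebra_simps eval_nat_numeral, rule three, use assms(2) cop in simp_all)
  moreover have "coprime (P x y) (x + 2 * y)"
    by (rule *[of _ _ "x^5 - 2*x^4*y - 11*x^3*y^2 + 2*x^2*y^3 - 4*x*y^4 + 14*y^5" "- 27 * y^6"])
      (simp add: P_def algebra_simps eval_nat_numeral, rule three, use assms(2) cop in \<open>presburger, simp\<close>)
  moreover have "coprime (P x y) (2 * x + y)"
    by (rule *[of _ _ "y^5 + 4*y^4*x - 8*y^3*x^2 - 4*y^2*x^3 - 7*y*x^4 + 14*x^5" "- 27 * x^6"])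
      (simp add: P_def algebra_simps eval_nat_numeral, rule three, use assms(2) cop in \<open>presburger, simp\<close>)
  ultimately show ?thesis by (simp add: Q_def)
qed

text \<open>After division by the gcd the coordinates are not both even, and then \<open>C\<close>
  is odd.\<close>

lemma C_nonzero:
  assumes "(x, y) \<noteq> (0, 0)"
  shows "C m x y \<noteq> 0"
proof -
  define g where "g = gcd x y"
  have "g \<noteq> 0" using assms by (auto simp: g_def)
  then obtain u v where "x = u * g" "y = v * g" and cop: "coprime u v"
    unfolding g_def using gcd_coprime_exists by metis
  then have uv: "x = g * u" "y = g * v" by (simp_all add: mult.commute)
  have "\<not> (even u \<and> even v)" using cop by (metis coprime_common_divisor odd_one)
  then have "odd (C m u v)" by (auto simp: C_def)
  then have "C m u v \<noteq> 0" by auto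
  moreover have "C m x y = g^3 * C m u v"
    by (simp add: C_def uv algebra_simps eval_nat_numeral)
  ultimately show ?thesis using \<open>g \<noteq> 0\<close> by simp
qed

lemma three_dvd_Q:
  fixes x y :: int
  shows "3 dvd Q x y"
proof -
  have "3 dvd x \<or> 3 dvd y \<or> 3 dvd x + y \<or> 3 dvd x - y" by presburger
  then show ?thesis by (auto simp: Q_def)
qed

text \<open>The factors \<open>x - y\<close>, \<open>x + 2 * y\<close> and \<open>2 * x + y\<close>
  each contribute a 3.\<close>

lemma twentyseven_dvd_Q:
  fixes x y :: int
  assumes "3 dvd x - y"
  shows "27 dvd Q x y"
proof -
  obtain k where k: "x = y + 3 * k" using assms by (metis dvdE diff_eq_eq add.commute)
  have "Q x y = 27 * (x * y * (x + y) * k * (y + k) * (y + 2 * k))"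
    by (simp add: k Q_def algebra_simps)
  then show ?thesis by simp
qed

text \<open>Modulo 3, \<open>Q\<close> vanishes and \<open>P\<close> becomes
  \<open>(x - y)^6\<close>.\<close>

lemma three_not_dvd_F:
  fixes x y :: int
  assumes "\<not> 3 dvd x - y"
  shows "\<not> 3 dvd F m x y"
proof
  assume "3 dvd F m x y"
  then have "3 dvd P x y" using three_dvd_Q[of x y]
    by (metis F_eq diff_add_cancel dvd_add dvd_mult)
  moreover have "P x y = (x - y)^6 + 3 * (2*x^5*y - 10*x^4*y^2 - 5*x^2*y^4 + 4*x*y^5)"
    by (simp add: P_def algebra_simps eval_nat_numeral)
  ultimately have "3 dvd (x - y)^6" by (simp add: dvd_add_left_iff)
  moreover have "prime (3::int)" by simp
  ultimately show False using assms prime_dvd_power by blast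
qed

section \<open>From rational points on the torus to integral solutions\<close>

text \<open>Modulo \<open>Q\<close> the form \<open>F m\<close> is \<open>P\<close>, so it is
  coprime to \<open>Q\<close> and must divide the other factor. If \<open>Q\<close> vanished, so
  would \<open>P\<close>, and the norm identity would force \<open>x = y = 0\<close>.\<close>

lemma coprime_solution:
  fixes m n x y :: int
  assumes eq: "(n - m) * F m x y = (m^2 + 3 * m + 9) * Q x y" and "n \<noteq> m"
    and cop: "coprime x y" and x3: "\<not> 3 dvd x - y"
  shows "F m x y dvd m^2 + 3 * m + 9" "Q x y \<noteq> 0"
proof -
  have F: "F m x y = P x y - m * Q x y" by (simp add: F_eq)
  have "coprime (F m x y) (Q x y)"
    using coprime_P_Q[OF cop x3] gcd_add_mult[of "Q x y" "- m" "P x y"]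
    by (simp add: F coprime_iff_gcd_eq_1 gcd.commute)
  moreover have "F m x y dvd (m^2 + 3 * m + 9) * Q x y" by (simp flip: eq)
  ultimately show "F m x y dvd m^2 + 3 * m + 9" by (simp add: coprime_dvd_mult_left_iff)
  show "Q x y \<noteq> 0"
  proof
    assume "Q x y = 0"
    with eq \<open>n \<noteq> m\<close> have "P x y = 0" by (simp add: F)
    with \<open>Q x y = 0\<close> have "(x^2 + x * y + y^2) ^ 6 = 0" using norm_P_Q[of x y] by simp
    moreover have "(x, y) \<noteq> (0, 0)" using cop by auto
    ultimately show False using form_pos[of x y] by simp
  qed
qed

text \<open>The factor 27 arises when \<open>x\<close> and \<open>y\<close> agree modulo 3: one step
  back along the order 6 map leads to \<open>coprime_solution\<close> and changes \<open>F m\<close>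
  by \<open>- 27\<close>.\<close>

lemma integral_solution:
  fixes m n x y :: int
  assumes eq: "(n - m) * F m x y = (m^2 + 3 * m + 9) * Q x y" and "n \<noteq> m" and cop: "coprime x y"
  shows "Q x y \<noteq> 0" "F m x y dvd 27 * (m^2 + 3 * m + 9)"
proof -
  have "Q x y \<noteq> 0 \<and> F m x y dvd 27 * (m^2 + 3 * m + 9)"
  proof (cases "3 dvd x - y")
    case False
    then show ?thesis using coprime_solution[OF eq \<open>n \<noteq> m\<close> cop] by (blast intro: dvd_mult)
  next
    case True
    \<comment> \<open>Apply the inverse of \<open>(u, v) \<mapsto> (u - v, u + 2 v)\<close>, which removes a factor \<open>- 27\<close> from both forms.\<close>
    then obtain k where k: "x = y + 3 * k" by (metis dvdE diff_eq_eq add.commute)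
    define u v where "u = y + 2 * k" and "v = - k"
    have xy: "x = u - v" "y = u + 2 * v" by (simp_all add: u_def v_def k)
    have "coprime u v"
    proof (rule coprimeI)
      fix c assume "c dvd u" "c dvd v"
      then have "c dvd x" "c dvd y" by (auto simp: xy)
      with cop show "is_unit c" by (rule coprime_common_divisor)
    qed
    moreover have "\<not> 3 dvd u - v"
    proof
      assume *: "3 dvd u - v"
      then have "3 dvd x" "3 dvd y" using True xy by presburger+
      with cop have "is_unit (3::int)" by (rule coprime_common_divisor)
      then show False by simp
    qed
    moreover have "(n - m) * F m u v = (m^2 + 3 * m + 9) * Q u v"
      using eq unfolding xy F_rot Q_rot by simp
    ultimately have "F m u v dvd m^2 + 3 * m + 9" "Q u v \<noteq> 0"
      using coprime_solution \<open>n \<noteq> m\<close> by blast+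
    then obtain k where "m^2 + 3 * m + 9 = F m u v * k" by (auto elim: dvdE)
    then have "27 * (m^2 + 3 * m + 9) = - 27 * F m u v * (- k)" by simp
    then have "- 27 * F m u v dvd 27 * (m^2 + 3 * m + 9)" by (rule dvdI)
    with \<open>Q u v \<noteq> 0\<close> show ?thesis unfolding xy F_rot Q_rot by simp
  qed
  then show "Q x y \<noteq> 0" "F m x y dvd 27 * (m^2 + 3 * m + 9)" by auto
qed

text \<open>Solving for \<open>n\<close> requires \<open>F m x y\<close> to divide
  \<open>(m^2 + 3 * m + 9) * Q x y\<close>. Either \<open>Q\<close> absorbs the 27, or
  \<open>F m x y\<close> is prime to 3. The value \<open>- m - 3\<close> is excluded by
  \<open>C_mult_C\<close>.\<close>

lemma solution_integral:
  fixes m x y :: int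
  assumes "Q x y \<noteq> 0" "F m x y dvd 27 * (m^2 + 3 * m + 9)"
  obtains n where "n \<noteq> m" "n \<noteq> - m - 3" "(n - m) * F m x y = (m^2 + 3 * m + 9) * Q x y"
proof -
  have "F m x y dvd (m^2 + 3 * m + 9) * Q x y"
  proof (cases "3 dvd x - y")
    case True
    then have "27 * (m^2 + 3 * m + 9) dvd Q x y * (m^2 + 3 * m + 9)"
      by (intro mult_dvd_mono twentyseven_dvd_Q) auto
    with assms(2) have "F m x y dvd Q x y * (m^2 + 3 * m + 9)" by (rule dvd_trans)
    then show ?thesis by (simp only: mult.commute)
  next
    case False
    have "prime (3 :: int)" by simp
    with three_not_dvd_F[OF False, of m] have "coprime 3 (F m x y)" by (rule prime_imp_coprime[rotated])
    then have "coprime (3 ^ 3) (F m x y)" by (rule coprime_power_left_iff[THEN iffD2, OF disjI1])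
    then have "coprime (F m x y) 27" by (simp add: coprime_commute)
    then show ?thesis using assms(2) by (simp only: coprime_dvd_mult_right_iff dvd_mult2)
  qed
  then obtain k where k: "(m^2 + 3 * m + 9) * Q x y = F m x y * k" by (auto elim: dvdE)
  show thesis
  proof (rule that[of "m + k"])
    show "m + k \<noteq> m" using k assms(1) disc_pos[of m] by auto
    show "m + k \<noteq> - m - 3"
    proof
      assume "m + k = - m - 3"
      then have "k = - (2 * m + 3)" by simp
      then have "(2 * m + 3) * F m x y + (m^2 + 3 * m + 9) * Q x y = 0"
        by (simp only: k) (simp add: algebra_simps)
      then have "C m x y * C m (x - y) (x + 2 * y) = 0"
        by (metis C_mult_C neg_equal_0_iff_equal)
      moreover have "(x, y) \<noteq> (0, 0)" "(x - y, x + 2 * y) \<noteq> (0, 0)"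
        using assms(1) by (auto simp: Q_def)
      ultimately show False using C_nonzero by auto
    qed
  qed (use k in \<open>simp add: mult.commute\<close>)
qed

section \<open>The order 6 map on the roots\<close>

text \<open>Multiplication by \<open>1 + \<rho>\<close>, read on the ratio
  \<open>x / y\<close>.\<close>

definition rot :: "'a::field \<Rightarrow> 'a" where
  "rot a = (a - 1) / (a + 2)"

context
  fixes m :: int and a :: "'a::field_char_0"
  assumes root: "F m a 1 = 0"
begin

text \<open>At a root \<open>P = m * Q\<close>, so by the norm identity \<open>Q\<close> and
  \<open>a^2 + a + 1\<close> vanish together; but no zero of a factor of \<open>Q\<close> is a zero
  of \<open>a^2 + a + 1\<close>.\<close>

lemma root_Q_nonzero: "Q a 1 \<noteq> 0"
  and root_form_nonzero: "a^2 + a + 1 \<noteq> 0"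
proof -
  have P: "P a 1 = of_int m * Q a 1" using root by (simp add: F_eq)
  have "of_int (m^2 + 3 * m + 9) * Q a 1 ^ 2 = (a^2 + a + 1) ^ 6"
    using norm_P_Q[of a 1] by (simp add: P power2_eq_square algebra_simps)
  moreover have "of_int (m^2 + 3 * m + 9) \<noteq> (0 :: 'a)"
    using disc_pos[of m] by (simp only: of_int_eq_0_iff)
  ultimately have iff: "a^2 + a + 1 = 0 \<longleftrightarrow> Q a 1 = 0"
    by (metis mult_eq_0_iff power_eq_0_iff zero_less_numeral)
  show "a^2 + a + 1 \<noteq> 0"
  proof
    assume *: "a^2 + a + 1 = 0"
    with iff have "a = 0 \<or> a = - 1 \<or> a = 1 \<or> a = - 2 \<or> 2 * a + 1 = 0"
      by (auto simp: Q_def eq_neg_iff_add_eq_0)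
    moreover have "(2 * a + 1)^2 + 3 = 4 * (a^2 + a + 1)" by (simp add: power2_eq_square algebra_simps)
    ultimately show False using * by auto
  qed
  with iff show "Q a 1 \<noteq> 0" by blast
qed

lemma root_nonzero: "a \<noteq> 0" "a + 1 \<noteq> 0" "a - 1 \<noteq> 0" "a + 2 \<noteq> 0" "2 * a + 1 \<noteq> 0" "1 - a \<noteq> 0"
  using root_Q_nonzero by (auto simp: Q_def)

lemma rot_root: "F m (rot a) 1 = 0"
proof -
  have "(a + 2) * rot a = a - 1" using root_nonzero by (simp add: rot_def)
  then have "(a + 2) ^ 6 * F m (rot a) 1 = F m (a - 1) (a + 2)"
    using F_homog[of m "a + 2" "rot a" 1] by simp
  also have "\<dots> = 0" using F_rot[of m a 1] root by simp
  finally show ?thesis using root_nonzero by simp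
qed

lemma rot_funpow:
  "(rot ^^ 2) a = - 1 / (a + 1)"
  "(rot ^^ 3) a = - (a + 2) / (2 * a + 1)"
  "(rot ^^ 4) a = - (a + 1) / a"
  "(rot ^^ 5) a = (2 * a + 1) / (1 - a)"
  "(rot ^^ 6) a = a"
proof -
  note nz = root_nonzero
  \<comment> \<open>Every second iterate picks up a common factor 3, because
    \<open>(1 + \<rho>)^2 = 3 * \<rho>\<close>.\<close>
  have cancel: "3 * x / (3 * y) = x / y" for x y :: 'a
    by (rule mult_divide_mult_cancel_left) simp
  have "rot ((a - 1) / (a + 2)) = 3 * (- 1) / (3 * (a + 1))"
    using nz by (simp add: rot_def divide_simps) (simp add: algebra_simps)?
  then have 2: "rot ((a - 1) / (a + 2)) = - 1 / (a + 1)" by (simp only: cancel)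
  have 3: "rot (- 1 / (a + 1)) = - (a + 2) / (2 * a + 1)"
    using nz by (simp add: rot_def divide_simps) (simp add: algebra_simps)?
  have "rot (- (a + 2) / (2 * a + 1)) = 3 * (- (a + 1)) / (3 * a)"
    using nz by (simp add: rot_def divide_simps) (simp add: algebra_simps)?
  then have 4: "rot (- (a + 2) / (2 * a + 1)) = - (a + 1) / a" by (simp only: cancel)
  have 5: "rot (- (a + 1) / a) = (2 * a + 1) / (1 - a)"
    using nz by (simp add: rot_def divide_simps) (simp add: algebra_simps)?
  have 6: "rot ((2 * a + 1) / (1 - a)) = 3 * a / 3"
    using nz by (simp add: rot_def divide_simps) (simp add: algebra_simps)?
  have steps: "(rot ^^ 2) a = rot (rot a)" "(rot ^^ 3) a = rot ((rot ^^ 2) a)"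
    "(rot ^^ 4) a = rot ((rot ^^ 3) a)" "(rot ^^ 5) a = rot ((rot ^^ 4) a)"
    "(rot ^^ 6) a = rot ((rot ^^ 5) a)"
    by (simp_all add: eval_nat_numeral)
  show "(rot ^^ 2) a = - 1 / (a + 1)" "(rot ^^ 3) a = - (a + 2) / (2 * a + 1)"
    "(rot ^^ 4) a = - (a + 1) / a" "(rot ^^ 5) a = (2 * a + 1) / (1 - a)"
    by (simp_all only: steps rot_def[of a] 2 3 4 5)
  show "(rot ^^ 6) a = a"
    by (simp only: steps rot_def[of a] 2 3 4 5 6) simp
qed

text \<open>For each of the five powers the fixed point equation is a multiple of
  \<open>a^2 + a + 1 = 0\<close>.\<close>

lemma rot_no_fixpoint:
  assumes "0 < i" "i < 6"
  shows "(rot ^^ i) a \<noteq> a"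
proof
  assume *: "(rot ^^ i) a = a"
  have "i = 1 \<or> i = 2 \<or> i = 3 \<or> i = 4 \<or> i = 5" using assms by auto
  moreover have [simp]: "rot a = (a - 1) / (a + 2)" by (simp add: rot_def)
  ultimately consider "(a - 1) / (a + 2) = a" | "- 1 / (a + 1) = a" | "- (a + 2) / (2 * a + 1) = a" |
    "- (a + 1) / a = a" | "(2 * a + 1) / (1 - a) = a"
    using * rot_funpow by auto
  then have "a^2 + a + 1 = 0"
  proof cases
    case 3
    then have "2 * (a^2 + a + 1) = 0"
      using root_nonzero by (simp add: divide_simps power2_eq_square) (simp add: algebra_simps)?
    then show ?thesis by (metis mult_eq_0_iff zero_neq_numeral)
  qed (use root_nonzero in \<open>simp_all add: divide_simps power2_eq_square\<close>, (simp_all add: neg_eq_iff_add_eq_0 algebra_simps)?)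
  then show False using root_form_nonzero by simp
qed

end

lemma rot_funpow_root: "F m a 1 = 0 \<Longrightarrow> F m ((rot ^^ i) a) 1 = 0" for a :: "'a::field_char_0"
  by (induction i) (simp_all add: rot_root)

lemma rot_funpow_eq_iff:
  fixes a :: "'a::field_char_0"
  assumes "F m a 1 = 0"
  shows "(rot ^^ i) a = (rot ^^ j) a \<longleftrightarrow> i mod 6 = j mod 6"
proof -
  have mod: "(rot ^^ (i mod 6)) a = (rot ^^ i) a" for i
    by (rule funpow_mod_eq) (rule rot_funpow(5)[OF assms])
  have inj: "i = j" if "i \<le> j" "j < 6" "(rot ^^ i) a = (rot ^^ j) a" for i j
  proof (rule ccontr)
    assume "i \<noteq> j"
    \<comment> \<open>Applying \<open>rot ^^ (6 - i)\<close> to both sides makes \<open>a\<close> a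
      fixed point of \<open>rot ^^ (j - i)\<close>.\<close>
    have "(rot ^^ (6 - i + j)) a = (rot ^^ (6 - i + i)) a"
      using that(3) by (simp only: funpow_add o_apply)
    also have "\<dots> = a" using that rot_funpow(5)[OF assms] by simp
    also have "(rot ^^ (6 - i + j)) a = (rot ^^ ((j - i) + 6)) a" using that by (simp add: add.commute)
    also have "\<dots> = (rot ^^ (j - i)) a" by (simp only: funpow_add o_apply rot_funpow(5)[OF assms])
    finally show False using rot_no_fixpoint[OF assms, of "j - i"] that \<open>i \<noteq> j\<close> by simp
  qed
  have "i mod 6 = j mod 6" if "(rot ^^ (i mod 6)) a = (rot ^^ (j mod 6)) a"
    using inj[of "i mod 6" "j mod 6"] inj[of "j mod 6" "i mod 6"] that by (metis nat_le_linear mod_less_divisor zero_less_numeral)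
  then show ?thesis using mod by metis
qed

section \<open>The roots in the algebraic closure as one orbit of \<open>rot\<close>\<close>

lemma ev_fC6: "ev (fC6 m) a = F m a 1"
  by (simp add: fC6_def F_def flip: of_int_minus)

lemma degree_fC6: "degree (fC6 m) = 6"
proof -
  have "fC6 m = [:1, of_int (2 * m + 6), of_int (5 * m), -20, of_int (- 5 * m - 15), of_int (- 2 * m), 1:]"
    by (simp add: fC6_def F_def of_int_poly numeral_poly eval_nat_numeral one_pCons algebra_simps)
  then show ?thesis by simp
qed

text \<open>The orbit of one root already has six elements, as many as the degree permits.\<close>

lemma roots_fC6:
  assumes "F m a 1 = 0"
  shows "{b. ev (fC6 m) b = 0} = (\<lambda>i. (rot ^^ i) a) ` {..<6}"
    and "card {b. ev (fC6 m) b = 0} = degree (fC6 m)"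
proof -
  let ?S = "(\<lambda>i. (rot ^^ i) a) ` {..<6::nat}"
  have "inj_on (\<lambda>i. (rot ^^ i) a) {..<6}"
    by (rule inj_onI) (simp add: rot_funpow_eq_iff[OF assms])
  then have card: "card ?S = 6" by (simp add: card_image)
  have "fC6 m \<noteq> 0" using degree_fC6[of m] by auto
  note fin = ev_roots[OF this, unfolded degree_fC6]
  have "?S \<subseteq> {b. ev (fC6 m) b = 0}"
    using rot_funpow_root[OF assms] by (auto simp: ev_fC6)
  then show eq: "{b. ev (fC6 m) b = 0} = ?S"
    by (rule card_seteq[OF fin(1), symmetric]) (simp add: card fin(2))
  show "card {b. ev (fC6 m) b = 0} = degree (fC6 m)" unfolding eq card degree_fC6 ..
qed

lemma rot_exponent:
  fixes a b :: "rat alg_closure"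
  assumes "F m a 1 = 0" "F m b 1 = 0"
  shows "\<exists>i. b = (rot ^^ i) a"
proof -
  have "b \<in> {b. ev (fC6 m) b = 0}" using assms(2) by (simp add: ev_fC6)
  then show ?thesis unfolding roots_fC6(1)[OF assms(1)] by auto
qed

lemma fC6_root_exists: "\<exists>a :: rat alg_closure. F m a 1 = 0"
proof -
  obtain a where "poly (map_poly to_ac (fC6 m)) a = 0"
    using alg_closed_imp_poly_has_root[of "map_poly to_ac (fC6 m)"] degree_fC6[of m] by auto
  then show ?thesis by (auto simp flip: ev_def simp: ev_fC6)
qed

lemma rot_closed:
  assumes "is_subfield K" "a \<in> K"
  shows "(rot ^^ i) a \<in> K"
proof (induction i)
  case (Suc i)
  note K = is_subfieldD[OF assms(1)]
  have "1 + 1 \<in> K" using K by blast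
  then have "2 \<in> K" by simp
  then show ?case using K Suc by (simp add: rot_def)
qed (use assms in simp)

text \<open>\<open>rot\<close> has rational coefficients, so one root yields all the others.\<close>

lemma L6_eq_adjoin:
  assumes "F m a 1 = 0"
  shows "L6 m = adjoin a"
  unfolding L6_def
proof (rule splitting_field_eq_adjoin)
  show "ev (fC6 m) a = 0" using assms by (simp add: ev_fC6)
  show "{b. ev (fC6 m) b = 0} \<subseteq> adjoin a"
    unfolding roots_fC6(1)[OF assms] using rot_closed[OF is_subfield_adjoin adjoin_self] by auto
qed

text \<open>Conjugation by the reciprocal inverts \<open>rot\<close>, and its inverse on roots is
  its fifth power.\<close>

lemma rot_recip:
  fixes a :: "'a::field_char_0"
  assumes "F m a 1 = 0"
  shows "(rot ^^ j) (1 / a) = 1 / (rot ^^ (5 * j)) a"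
proof (induction j)
  case (Suc j)
  define b where "b = (rot ^^ (5 * j)) a"
  have b: "F m b 1 = 0" unfolding b_def by (rule rot_funpow_root[OF assms])
  have "(rot ^^ Suc j) (1 / a) = rot (1 / b)" by (simp add: Suc b_def)
  also have "\<dots> = 1 / (rot ^^ 5) b"
    unfolding rot_funpow(4)[OF b] using root_nonzero[OF b] by (simp add: rot_def divide_simps) (simp add: algebra_simps)
  also have "(rot ^^ 5) b = (rot ^^ (5 + 5 * j)) a" by (simp only: funpow_add o_apply b_def)
  finally show ?case by simp
qed simp

lemma F_recip: 
  fixes a :: "'a::field_char_0"
  assumes "F m a 1 = 0" 
  shows "F (- m - 3) (1 / a) 1 = 0"
proof -
  have "a ^ 6 * F (- m - 3) (1 / a) 1 = F (- m - 3) 1 a"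
    using F_homog[of "- m - 3" a "1 / a" 1] root_nonzero(1)[OF assms] by simp
  then show ?thesis using F_neg[of m 1 a] assms root_nonzero(1)[OF assms] by simp
qed

section \<open>The torus element carrying one root to another\<close>

lemma root_inj:
  fixes a :: "'a::field_char_0"
  assumes "F m a 1 = 0" "F n a 1 = 0"
  shows "m = n"
proof -
  have "of_int m * Q a 1 = of_int n * Q a 1" using assms by (simp add: F_eq)
  then show ?thesis using root_Q_nonzero[OF assms(1)] by simp
qed

text \<open>The ratio is \<open>u / v\<close> solved from
  \<open>a = (u * b - v) / (v * b + u + v)\<close>. It is invariant because \<open>rot\<close> lies
  in the torus, which is commutative.\<close>

lemma torus_ratio_rot:
  fixes a b :: "'a::field_char_0"
  assumes "F m a 1 = 0" "F n b 1 = 0" "m \<noteq> n"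
  shows "(rot a * rot b + rot a + 1) / (rot b - rot a) = (a * b + a + 1) / (b - a)"
proof -
  note nz = root_nonzero[OF assms(1)] root_nonzero[OF assms(2)]
  have "a \<noteq> b" using root_inj assms by blast
  have "rot b - rot a = 3 * (b - a) / ((a + 2) * (b + 2))"
    using nz by (simp add: rot_def divide_simps) (simp add: algebra_simps)
  moreover have "rot a * rot b + rot a + 1 = 3 * (a * b + a + 1) / ((a + 2) * (b + 2))"
    using nz by (simp add: rot_def divide_simps) (simp add: algebra_simps)
  ultimately show ?thesis using nz \<open>a \<noteq> b\<close> by (simp del: distrib_left_numeral right_diff_distrib_numeral)
qed

text \<open>Here \<open>(u, v)\<close> composed with \<open>(b, 1)\<close> is \<open>N\<close> times
  \<open>(a, 1)\<close>. Insert this into the composition laws, use \<open>P = m * Q\<close> at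
  \<open>a\<close> and \<open>P = n * Q\<close> at \<open>b\<close>, and cancel
  \<open>Q b 1\<close>.\<close>

lemma torus_ratio_solution:
  fixes a b :: "'a::field_char_0"
  assumes a: "F m a 1 = 0" and b: "F n b 1 = 0"
  defines "u \<equiv> a * b + a + 1" and "v \<equiv> b - a"
  shows "of_int (n - m) * F m u v = of_int (m^2 + 3 * m + 9) * Q u v"
proof -
  define N where "N = b^2 + b + 1"
  have uv: "u * b - v * 1 = N * a" "v * b + u * 1 + v * 1 = N * 1"
    by (simp_all add: u_def v_def N_def power2_eq_square algebra_simps)
  have Pa: "P a 1 = of_int m * Q a 1" and Pb: "P b 1 = of_int n * Q b 1"
    using a b by (simp_all add: F_eq)
  have "P u v * P b 1 - 9 * (Q u v * Q b 1) = N ^ 6 * P a 1"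
    using P_mult[of u b v 1] unfolding uv P_homog by simp
  moreover have "P u v * Q b 1 + Q u v * P b 1 + 3 * (Q u v * Q b 1) = N ^ 6 * Q a 1"
    using Q_mult[of u b v 1] unfolding uv Q_homog by simp
  ultimately have "P u v * P b 1 - 9 * (Q u v * Q b 1) 
      = of_int m * (P u v * Q b 1 + Q u v * P b 1 + 3 * (Q u v * Q b 1))"
    by (simp add: Pa)
  then have "Q b 1 * (of_int n * P u v - 9 * Q u v) 
      = Q b 1 * (of_int m * (P u v + of_int n * Q u v + 3 * Q u v))"
    by (simp add: Pb algebra_simps)
  then have "of_int n * P u v - 9 * Q u v = of_int m * (P u v + of_int n * Q u v + 3 * Q u v)"
    using root_Q_nonzero[OF b] by simp
  then show ?thesis by (simp add: F_eq power2_eq_square algebra_simps)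
qed

section \<open>Equality of the splitting fields\<close>

lemma L6_subfield: "is_subfield (L6 m)" "range to_ac \<subseteq> L6 m" "of_int k \<in> L6 m" "F m a 1 = 0 \<Longrightarrow> a \<in> L6 m"
  using splitting_field_subfield(1-3)[where p = "fC6 m"] splitting_field_subfield(2)[where c = "of_int k"]
  by (auto simp: L6_def ev_fC6)

text \<open>By \<open>factor\<close>, the torus map given by \<open>(x, y)\<close> takes roots of
  \<open>F n\<close> to roots of \<open>F m\<close>; it and its inverse have rational
  coefficients.\<close>

lemma torus_solution_imp_L6_eq:
  fixes x y :: int
  assumes eq: "(n - m) * F m x y = (m^2 + 3 * m + 9) * Q x y" and Q: "Q x y \<noteq> 0" and F: "F m x y \<noteq> 0"
  shows "L6 n = L6 m"
proof -
  define u v N :: "rat alg_closure" where "u = of_int x" and "v = of_int y" and "N = u^2 + u * v + v^2"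
  have v: "v \<noteq> 0" using Q by (auto simp: v_def Q_def)
  have Fuv: "F m u v \<noteq> 0" using F by (simp add: u_def v_def F_of_int)
  have "N = of_int (x^2 + x * y + y^2)" by (simp add: N_def u_def v_def)
  moreover have "(x, y) \<noteq> (0, 0)" using Q by (auto simp: Q_def)
  ultimately have N: "N \<noteq> 0" using form_pos[of x y] by (metis less_irrefl of_int_eq_0_iff)
  have eq': "of_int (n - m) * (P u v - of_int m * Q u v) = of_int (m^2 + 3 * m + 9) * Q u v"
  proof -
    have "of_int (n - m) * F m u v = of_int (m^2 + 3 * m + 9) * Q u v"
      by (simp only: u_def v_def F_of_int Q_of_int eq flip: of_int_mult)
    then show ?thesis by (simp only: F_eq)
  qed
  have factor: "F m (u * b - v) (v * b + u + v) = F m u v * F n b 1" for b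
  proof -
    have "F m (u * b - v) (v * b + u + v) = 
       P b 1 * (P u v - of_int m * Q u v) 
       - Q b 1 * (of_int m * (P u v - of_int m * Q u v) + of_int (m^2 + 3 * m + 9) * Q u v)"
      using P_mult[of u b v 1] Q_mult[of u b v 1] by (simp add: F_eq power2_eq_square algebra_simps)
    also have "\<dots> = F m u v * F n b 1"
      unfolding eq'[symmetric] by (simp add: F_eq algebra_simps)
    finally show ?thesis .
  qed
  \<comment> \<open>The second quotient is the inverse fractional linear map.\<close>
  have in_L6: "(u * b - v) / (v * b + u + v) \<in> L6 k" "((u + v) * b + v) / (u - v * b) \<in> L6 k"
    if b: "b \<in> L6 k" for b k
  proof -
    note K = is_subfieldD(5-8)[OF L6_subfield(1)[of k]]
    have uv: "u \<in> L6 k" "v \<in> L6 k" unfolding u_def v_def by (rule L6_subfield(3))+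
    show "(u * b - v) / (v * b + u + v) \<in> L6 k" "((u + v) * b + v) / (u - v * b) \<in> L6 k"
      by (intro K uv b)+
  qed
  \<comment> \<open>If \<open>u = v * a\<close>, homogeneity would give
    \<open>F m u v = v^6 * F m a 1 = 0\<close>.\<close>
  have nz: "u - v * a \<noteq> 0" if "F m a 1 = 0" for a
    using F_homog[of m v a 1] that Fuv by auto
  have "a \<in> L6 n" if a: "F m a 1 = 0" for a
  proof -
    define b where "b = ((u + v) * a + v) / (u - v * a)"
    define w where "w = u - v * a"
    have w: "w \<noteq> 0" using nz[OF a] by (simp add: w_def)
    then have bw: "b * w = (u + v) * a + v" by (simp add: b_def w_def)
    have "(u * b - v) * w = u * (b * w) - v * w" by (simp add: algebra_simps)
    also have "\<dots> = N * a"
      unfolding bw by (simp add: w_def N_def power2_eq_square algebra_simps)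
    finally have 1: "u * b - v = N / w * a" using w by (simp add: nonzero_eq_divide_eq)
    have "(v * b + u + v) * w = v * (b * w) + (u + v) * w" by (simp add: algebra_simps)
    also have "\<dots> = N"
      unfolding bw by (simp add: w_def N_def power2_eq_square algebra_simps)
    finally have 2: "v * b + u + v = N / w * 1" using w by (simp add: nonzero_eq_divide_eq)
    have "F m u v * F n b 1 = (N / w) ^ 6 * F m a 1"
      unfolding factor[symmetric] 1 2 by (rule F_homog)
    then have "F n b 1 = 0" using a Fuv by simp
    moreover have "a = (u * b - v) / (v * b + u + v)" unfolding 1 2 using N w by simp
    ultimately show ?thesis using in_L6(1) L6_subfield(4) by metis
  qed
  then have "L6 m \<subseteq> L6 n"
    unfolding L6_def[of m] using L6_subfield by (intro splitting_field_subfield(4)) (auto simp: ev_fC6)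
  moreover have "b \<in> L6 m" if b: "F n b 1 = 0" for b
  proof -
    \<comment> \<open>A zero denominator would make \<open>F m (u * b - v) 0\<close>, which is
      \<open>(u * b - v)^6\<close>, vanish as well, and then \<open>N = 0\<close>.\<close>
    have s: "v * b + u + v \<noteq> 0"
    proof
      assume s: "v * b + u + v = 0"
      then have "F m (u * b - v) 0 = 0" using factor[of b] b by simp
      then have "u * b - v = 0" by (simp add: F_def)
      then have "N = u * (v * b + u + v) - v * (u * b - v)"
        by (simp add: N_def power2_eq_square algebra_simps)
      with N s \<open>u * b - v = 0\<close> show False by simp
    qed
    define a where "a = (u * b - v) / (v * b + u + v)"
    have "(v * b + u + v) * a = u * b - v" using s by (simp add: a_def)
    then have a: "F m a 1 = 0"
      using factor[of b] b s F_homog[of m "v * b + u + v" a 1] by simp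
    define w where "w = v * b + u + v"
    have w: "w \<noteq> 0" using s by (simp add: w_def)
    have aw: "a * w = u * b - v" using s by (simp add: a_def w_def)
    have "(u - v * a) * w = u * w - v * (a * w)" by (simp add: algebra_simps)
    also have "\<dots> = N"
      unfolding aw by (simp add: w_def N_def power2_eq_square algebra_simps)
    finally have 1: "u - v * a = N / w" using w by (simp add: nonzero_eq_divide_eq)
    have "((u + v) * a + v) * w = (u + v) * (a * w) + v * w" by (simp add: algebra_simps)
    also have "\<dots> = N * b"
      unfolding aw by (simp add: w_def N_def power2_eq_square algebra_simps)
    finally have 2: "(u + v) * a + v = N / w * b" using w by (simp add: nonzero_eq_divide_eq)
    have "b = ((u + v) * a + v) / (u - v * a)" unfolding 1 2 using N w by simp
    then show ?thesis using in_L6(2) L6_subfield(4)[OF a] by simp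
  qed
  then have "L6 n \<subseteq> L6 m"
    unfolding L6_def[of n] using L6_subfield by (intro splitting_field_subfield(4)) (auto simp: ev_fC6)
  ultimately show ?thesis by blast
qed

text \<open>
  Let \<open>\<tau>\<close> act with exponents \<open>j\<close> and \<open>i\<close>. A power of \<open>\<tau>\<close> fixes \<open>a\<close> iff it fixes \<open>b\<close>, so \<open>j\<close> and \<open>i\<close>
  have the same order modulo 6, which forces \<open>i = \<plusminus>j\<close>. Two automorphisms with different signs are
  excluded by looking at their composition. Since \<open>5 = - 1\<close> modulo 6, \<open>5 * j\<close> stands for \<open>- j\<close>.
\<close>
lemma aut_exponents:
  fixes a b :: "rat alg_closure"
  assumes a: "F m a 1 = 0" and b: "F n b 1 = 0" and ab: "adjoin a = adjoin b"
  defines "G \<equiv> aut (adjoin a)"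
  shows "(\<forall>\<tau>\<in>G. \<exists>j. \<tau> a = (rot ^^ j) a \<and> \<tau> b = (rot ^^ j) b) \<or>
    (\<forall>\<tau>\<in>G. \<exists>j. \<tau> a = (rot ^^ j) a \<and> \<tau> b = (rot ^^ (5 * j)) b)"
proof -
  let ?K = "adjoin a"
  have aK: "a \<in> ?K" and bK: "b \<in> ?K" unfolding ab by simp_all (simp add: ab [symmetric])
  note K = is_subfield_adjoin[of a]
  have to_ac: "range to_ac \<subseteq> ?K" by auto
  note G = autD[OF _ K to_ac, folded G_def]
  have rot: "\<tau> ((rot ^^ i) x) = (rot ^^ i) (\<tau> x)" if \<tau>: "\<tau> \<in> G" and x: "x \<in> ?K" for \<tau> i x
  proof (induction i)
    case (Suc i)
    define z where "z = (rot ^^ i) x"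
    have z: "z \<in> ?K" unfolding z_def by (rule rot_closed[OF K x])
    have 12: "1 \<in> ?K" "2 \<in> ?K" "\<tau> 1 = 1" "\<tau> 2 = 2"
      using to_ac_in_adjoin[of 1 a] to_ac_in_adjoin[of 2 a] G(1)[OF \<tau>, of 1] G(1)[OF \<tau>, of 2]
      by simp_all
    then have "z - 1 \<in> ?K" "z + 2 \<in> ?K" using is_subfieldD(5,6)[OF K] z by simp_all
    then have "\<tau> (rot z) = rot (\<tau> z)" using G(3,5,6)[OF \<tau>] z 12 by (simp add: rot_def)
    then show ?case using Suc by (simp add: z_def)
  qed simp
  have exps: "\<exists>j i. \<tau> a = (rot ^^ j) a \<and> \<tau> b = (rot ^^ i) b" if "\<tau> \<in> G" for \<tau>
  proof -
    have "F m (\<tau> a) 1 = 0" "F n (\<tau> b) 1 = 0"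
      using G(7)[OF that aK, of "fC6 m"] G(7)[OF that bK, of "fC6 n"] G(1)[OF that, of 0] a b
      by (simp_all add: ev_fC6)
    then show ?thesis using rot_exponent[OF a] rot_exponent[OF b] by blast
  qed
  have order: "6 dvd k * j \<longleftrightarrow> 6 dvd k * i"
    if \<tau>: "\<tau> \<in> G" and ji: "\<tau> a = (rot ^^ j) a" "\<tau> b = (rot ^^ i) b" for \<tau> j i k
  proof -
    have "\<tau> ^^ k \<in> G"
      using \<tau> by (induction k) (auto simp: G_def aut_comp, simp add: aut_def)
    have iter: "(\<tau> ^^ k) x = (rot ^^ (k * l)) x" if "x \<in> ?K" "\<tau> x = (rot ^^ l) x" for x l
      by (induction k) (simp_all add: rot[OF \<tau>] that funpow_add, metis add.commute comp_apply funpow_add)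
    \<comment> \<open>\<open>a\<close> and \<open>b\<close> are polynomials in each other, so
      \<open>\<tau> ^^ k\<close> fixes both or neither.\<close>
    obtain p where "b = ev p a" using bK unfolding adjoin_def by blast
    moreover obtain q where "a = ev q b" using aK[unfolded ab] unfolding adjoin_def by blast
    ultimately have "(\<tau> ^^ k) a = a \<longleftrightarrow> (\<tau> ^^ k) b = b"
      using G(7)[OF \<open>\<tau> ^^ k \<in> G\<close>] aK bK by metis
    then show ?thesis
      unfolding iter[OF aK ji(1)] iter[OF bK ji(2)]
      using rot_funpow_eq_iff[OF a, of _ 0] rot_funpow_eq_iff[OF b, of _ 0] by (simp add: mod_eq_0_iff_dvd)
  qed
  have sign: "i mod 6 = j mod 6 \<or> i mod 6 = (5 * j) mod 6"
    if "\<tau> \<in> G" "\<tau> a = (rot ^^ j) a" "\<tau> b = (rot ^^ i) b" for \<tau> j i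
  proof -
    define r s where "r = j mod 6" and "s = i mod 6"
    have red: "6 dvd k * j \<longleftrightarrow> 6 dvd k * r" "6 dvd k * i \<longleftrightarrow> 6 dvd k * s" for k
      by (simp_all add: dvd_eq_mod_eq_0 mod_mult_right_eq r_def s_def)
    \<comment> \<open>Multipliers 1, 2 and 3 separate the orders, whose classes modulo 6 are
      \<open>{0}\<close>, \<open>{3}\<close>, \<open>{2, 4}\<close> and
      \<open>{1, 5}\<close>.\<close>
    have "r \<in> {0, 1, 2, 3, 4, 5}" "s \<in> {0, 1, 2, 3, 4, 5}" by (auto simp: r_def s_def)
    then have "s = r \<or> s = (5 * r) mod 6"
      using order[OF that, of 1] order[OF that, of 2] order[OF that, of 3] unfolding red by auto
    then show ?thesis by (simp add: r_def s_def mod_mult_right_eq)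
  qed
  show ?thesis
  proof (rule ccontr)
    assume "\<not> ?thesis"
    then obtain \<sigma> \<tau> where \<sigma>: "\<sigma> \<in> G" "\<nexists>j. \<sigma> a = (rot ^^ j) a \<and> \<sigma> b = (rot ^^ (5 * j)) b"
      and \<tau>: "\<tau> \<in> G" "\<nexists>j. \<tau> a = (rot ^^ j) a \<and> \<tau> b = (rot ^^ j) b" by blast
    obtain j i where ji: "\<sigma> a = (rot ^^ j) a" "\<sigma> b = (rot ^^ i) b" using exps[OF \<sigma>(1)] by blast
    obtain k l where kl: "\<tau> a = (rot ^^ k) a" "\<tau> b = (rot ^^ l) b" using exps[OF \<tau>(1)] by blast
    have i: "i mod 6 \<noteq> (5 * j) mod 6" using \<sigma>(2) ji rot_funpow_eq_iff[OF b] by metis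
    have l: "l mod 6 \<noteq> k mod 6" using \<tau>(2) kl rot_funpow_eq_iff[OF b] by metis
    have d: "(c + d) mod 6 = c mod 6 \<longleftrightarrow> 6 dvd d" for c d :: nat
      using mod_eq_dvd_iff_nat[of c "c + d" 6] by simp
    have ij: "i mod 6 = j mod 6" using sign[OF \<sigma>(1) ji] i by blast
    have lk: "l mod 6 = (5 * k) mod 6" using sign[OF \<tau>(1) kl] l by blast
    \<comment> \<open>Modulo 6, \<open>i = j\<close> and \<open>l = - k\<close>, so the composition
      has exponents \<open>k + j\<close> and \<open>j - k\<close>. Either sign forces
      \<open>2 * k = 0\<close> or \<open>2 * j = 0\<close>, which makes the two signs coincide for
      \<open>\<tau>\<close> or for \<open>\<sigma>\<close>.\<close>
    have "(l + i) mod 6 = (k + j) mod 6 \<or> (l + i) mod 6 = (5 * (k + j)) mod 6"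
    proof (rule sign)
      show "\<sigma> \<circ> \<tau> \<in> G" using aut_comp \<sigma>(1) \<tau>(1) unfolding G_def by blast
      show "(\<sigma> \<circ> \<tau>) a = (rot ^^ (k + j)) a" "(\<sigma> \<circ> \<tau>) b = (rot ^^ (l + i)) b"
        using rot[OF \<sigma>(1)] aK bK by (simp_all add: kl ji funpow_add)
    qed
    also have "(l + i) mod 6 = (5 * k + j) mod 6" using ij lk by (metis mod_add_cong)
    finally have "(k + j + 4 * k) mod 6 = (k + j) mod 6 \<or> (5 * k + j + 4 * j) mod 6 = (5 * k + j) mod 6"
      by (auto simp: algebra_simps)
    then have "6 dvd 4 * k \<or> 6 dvd 4 * j" unfolding d .
    moreover have "(k + 4 * k) mod 6 \<noteq> k mod 6" "(j + 4 * j) mod 6 \<noteq> j mod 6" using i l ij lk by simp_all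
    then have "\<not> 6 dvd 4 * k" "\<not> 6 dvd 4 * j" unfolding d .
    ultimately show False by blast
  qed
qed

lemma torus_ratio_rot_funpow:
  fixes a b :: "'a::field_char_0"
  assumes "F m a 1 = 0" "F n b 1 = 0" "m \<noteq> n"
  defines "a' i \<equiv> (rot ^^ i) a" and "b' i \<equiv> (rot ^^ i) b"
  shows "(a' i * b' i + a' i + 1) / (b' i - a' i) = (a * b + a + 1) / (b - a)"
proof (induction i)
  case (Suc i)
  have "F m (a' i) 1 = 0" "F n (b' i) 1 = 0"
    unfolding a'_def b'_def by (rule rot_funpow_root, fact)+
  from torus_ratio_rot[OF this assms(3)] show ?case
    using Suc by (simp add: a'_def b'_def)
qed (simp add: a'_def b'_def)

lemma L6_eq_imp_torus_solution:
  assumes "L6 n = L6 m" "n \<noteq> m" "n \<noteq> - m - 3"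
  obtains k x y where "k \<noteq> m" "coprime x y" "(k - m) * F m x y = (m^2 + 3 * m + 9) * Q x y"
proof -
  obtain a b :: "rat alg_closure" where a: "F m a 1 = 0" and b: "F n b 1 = 0"
    using fC6_root_exists by metis
  have ab: "adjoin a = adjoin b" using L6_eq_adjoin[OF a] L6_eq_adjoin[OF b] assms(1) by simp
  let ?K = "adjoin a"
  have aK: "a \<in> ?K" and bK: "b \<in> ?K" unfolding ab by simp_all (simp add: ab [symmetric])
  note K = is_subfield_adjoin[of a] and autD = autD[OF _ is_subfield_adjoin[of a]]
  have to_ac: "range to_ac \<subseteq> ?K" by auto
  \<comment> \<open>Take \<open>(k, c)\<close> to be \<open>(n, b)\<close> or
    \<open>(- n - 3, 1 / b)\<close> according to the sign; excluding \<open>m\<close> and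
    \<open>- m - 3\<close> gives \<open>k \<noteq> m\<close> in both cases.\<close>
  obtain k c where k: "k \<noteq> m" and c: "F k c 1 = 0" and cK: "c \<in> ?K"
    and equi: "\<And>\<tau>. \<tau> \<in> aut ?K \<Longrightarrow> \<exists>j. \<tau> a = (rot ^^ j) a \<and> \<tau> c = (rot ^^ j) c"
    using aut_exponents[OF a b ab]
  proof
    assume "\<forall>\<tau>\<in>aut ?K. \<exists>j. \<tau> a = (rot ^^ j) a \<and> \<tau> b = (rot ^^ j) b"
    then show thesis using that[of n b] assms(2) b bK by blast
  next
    assume *: "\<forall>\<tau>\<in>aut ?K. \<exists>j. \<tau> a = (rot ^^ j) a \<and> \<tau> b = (rot ^^ (5 * j)) b"
    have "\<exists>j. \<tau> a = (rot ^^ j) a \<and> \<tau> (1 / b) = (rot ^^ j) (1 / b)" if \<tau>: "\<tau> \<in> aut ?K" for \<tau>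
    proof -
      have "\<tau> 1 = 1" using autD(1)[OF \<tau> to_ac, of 1] by simp
      then have "\<tau> (1 / b) = 1 / \<tau> b"
        using autD(6)[OF \<tau> to_ac is_subfieldD(1)[OF K] bK] by simp
      moreover obtain j where "\<tau> a = (rot ^^ j) a" "\<tau> b = (rot ^^ (5 * j)) b" using * \<tau> by blast
      ultimately show ?thesis by (intro exI[of _ j]) (simp add: rot_recip[OF b])
    qed
    moreover have "1 / b \<in> ?K" by (rule is_subfieldD(8)[OF K is_subfieldD(1)[OF K] bK])
    ultimately show thesis using that[of "- n - 3" "1 / b"] F_recip[OF b] assms(3) by simp
  qed
  \<comment> \<open>\<open>u / v\<close> is the torus element that carries \<open>c\<close> to
    \<open>a\<close>.\<close>
  define u v where "u = a * c + a + 1" and "v = c - a"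
  have "v \<noteq> 0" using root_inj[OF a, of k] c k by (auto simp: v_def)
  have uvK: "u \<in> ?K" "v \<in> ?K" "1 \<in> ?K" "a * c \<in> ?K" "a * c + a \<in> ?K"
    unfolding u_def v_def by (intro is_subfieldD(1,5-7)[OF K] aK cK)+
  have "u / v \<in> range to_ac"
  proof (rule fixed_field_adjoin)
    show "fC6 m \<noteq> 0" using degree_fC6[of m] by auto
    show "ev (fC6 m) a = 0" using a by (simp add: ev_fC6)
    show "card {b. ev (fC6 m) b = 0} = degree (fC6 m)" by (rule roots_fC6(2)[OF a])
    show "{b. ev (fC6 m) b = 0} \<subseteq> ?K"
      unfolding roots_fC6(1)[OF a] using rot_closed[OF K aK] by auto
    show "u / v \<in> ?K" using is_subfieldD(8)[OF K] uvK by blast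
    fix \<tau> assume \<tau>: "\<tau> \<in> aut ?K"
    note \<tau>D = autD[OF \<tau> to_ac]
    obtain j where j: "\<tau> a = (rot ^^ j) a" "\<tau> c = (rot ^^ j) c" using equi[OF \<tau>] by blast
    have "\<tau> (u / v) = (\<tau> a * \<tau> c + \<tau> a + 1) / (\<tau> c - \<tau> a)"
      using \<tau>D(6)[OF uvK(1,2)] \<tau>D(3)[OF uvK(5,3)] \<tau>D(3)[OF uvK(4) aK] \<tau>D(4)[OF aK cK] \<tau>D(5)[OF cK aK] \<tau>D(1)[of 1]
      by (simp add: u_def v_def)
    also have "\<dots> = u / v"
      unfolding j u_def v_def using torus_ratio_rot_funpow[OF a c] k by blast
    finally show "\<tau> (u / v) = u / v" .
  qed
  then obtain q where q: "u / v = to_ac q" by blast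
  obtain x y where xy: "quotient_of q = (x, y)" by fastforce
  then have "y \<noteq> 0" "coprime x y" "q = of_int x / of_int y"
    using quotient_of_denom_pos[of q] quotient_of_coprime quotient_of_div by auto
  then have ratio: "u / v = of_int x / of_int y" using q by simp
  \<comment> \<open>Scaling by \<open>t\<close> replaces \<open>(u, v)\<close> by the integers
    \<open>(x, y)\<close>; both sides of the equation are homogeneous of degree 6.\<close>
  define t where "t = of_int y / v"
  have t: "t * u = of_int x" "t * v = of_int y"
    using ratio \<open>v \<noteq> 0\<close> \<open>y \<noteq> 0\<close> by (simp_all add: t_def divide_simps mult.commute)
  have "of_int (k - m) * (t ^ 6 * F m u v) = t ^ 6 * (of_int (k - m) * F m u v)"
    by (rule mult.left_commute)
  also have "\<dots> = t ^ 6 * (of_int (m^2 + 3 * m + 9) * Q u v)"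
    unfolding u_def v_def torus_ratio_solution[OF a c] ..
  also have "\<dots> = of_int (m^2 + 3 * m + 9) * (t ^ 6 * Q u v)"
    by (rule mult.left_commute)
  finally have "of_int ((k - m) * F m x y) = (of_int ((m^2 + 3 * m + 9) * Q x y) :: rat alg_closure)"
    by (simp only: t F_of_int Q_of_int of_int_mult flip: F_homog Q_homog)
  then have "(k - m) * F m x y = (m^2 + 3 * m + 9) * Q x y" by (simp only: of_int_eq_iff)
  with k \<open>coprime x y\<close> that show thesis by blast
qed

theorem theorem5p1:
  fixes m :: int
  shows "(\<exists>n::int. n \<notin> {m, - m - 3} \<and> L6 n = L6 m) \<longleftrightarrow>
    (\<exists>(x::int) (y::int) (d::int).
       x * y * (x + y) * (x - y) * (x + 2 * y) * (2 * x + y) \<noteq> 0 \<and>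
       d dvd 27 * (m^2 + 3 * m + 9) \<and> F m x y = d)"
proof
  assume "\<exists>n::int. n \<notin> {m, - m - 3} \<and> L6 n = L6 m"
  then obtain k x y where "k \<noteq> m" "coprime x y" "(k - m) * F m x y = (m^2 + 3 * m + 9) * Q x y"
    using L6_eq_imp_torus_solution by (metis insertCI)
  then show "\<exists>(x::int) (y::int) (d::int).
      x * y * (x + y) * (x - y) * (x + 2 * y) * (2 * x + y) \<noteq> 0 \<and>
      d dvd 27 * (m^2 + 3 * m + 9) \<and> F m x y = d"
    using integral_solution unfolding Q_def by blast
next
  assume "\<exists>(x::int) (y::int) (d::int).
      x * y * (x + y) * (x - y) * (x + 2 * y) * (2 * x + y) \<noteq> 0 \<and>
      d dvd 27 * (m^2 + 3 * m + 9) \<and> F m x y = d"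
  then obtain x y :: int where xy: "Q x y \<noteq> 0" "F m x y dvd 27 * (m^2 + 3 * m + 9)"
    unfolding Q_def by blast
  then obtain n where "n \<noteq> m" "n \<noteq> - m - 3" "(n - m) * F m x y = (m^2 + 3 * m + 9) * Q x y"
    by (rule solution_integral)
  \<comment> \<open>Zero divides only zero, whereas \<open>27 * (m^2 + 3 * m + 9)\<close> is
    positive.\<close>
  moreover have "F m x y \<noteq> 0" using xy(2) disc_pos[of m] by auto
  ultimately show "\<exists>n::int. n \<notin> {m, - m - 3} \<and> L6 n = L6 m"
    using torus_solution_imp_L6_eq xy(1) by blast
qed

end
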